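(* Let $\Lambda_A,\Lambda_B$ be a pair of simplicial complexes of dimension $n\le 3$. Then there exist simplicial complexes $\Gamma_A$ and $\Gamma_B$, homeomorphic to $\Lambda_A$ and $\Lambda_B$ respectively, which admit $(n+1)$-colourings with respect to which the pair $\Gamma_A,\Gamma_B$ is pairwise 5-large.
   Context: All simplicial complexes are finite. An $m$-coloured simplicial complex is a simplicial complex whose vertex set is partitioned into $m$ labelled (possibly empty) classes, the colours $1,\dots,m$, so that adjacent vertices have different colours; such a partition is an $m$-colouring. A simplicial complex is flag if every set of pairwise adjacent vertices spans a simplex. A square in a simplicial complex is a cycle $(v_1,v_2,v_3,v_4)$ of length $4$ in its $1$-skeleton; it is flat if neither pair of diagonally opposite vertices is joined by an edge. Two $m$-coloured flag simplicial complexes (with the same $m$) are pairwise 5-large if, whenever $(v_1,v_2,v_3,v_4)$ is a flat square in one of the complexes, with $v_j$ of colour $k_j$, there exists $j\in\{1,\dots,4\}$ such that the other complex contains no flat square having two adjacent vertices of colours $k_j$ and $k_{j+1}$ (indices mod $4$). In particular, pairwise 5-large complexes are flag by definition. *)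

theory Defs
  imports "HOL-Analysis.Analysis"
begin

(* A finite abstract simplicial complex is given by its set of simplices. The empty set is not
   counted as a simplex, so that {} is the only complex without vertices. *)
definition simplicial_cx :: "'v set set \<Rightarrow> bool" where
  "simplicial_cx K \<longleftrightarrow> finite K \<and>
     (\<forall>S\<in>K. finite S \<and> S \<noteq> {} \<and> (\<forall>T. T \<subseteq> S \<and> T \<noteq> {} \<longrightarrow> T \<in> K))"

definition cx_vertices :: "'v set set \<Rightarrow> 'v set" where
  "cx_vertices K = {v. {v} \<in> K}"

definition cx_adj :: "'v set set \<Rightarrow> 'v \<Rightarrow> 'v \<Rightarrow> bool" where
  "cx_adj K u v \<longleftrightarrow> u \<noteq> v \<and> {u, v} \<in> K"

(* The 0 inserted only matters for the complex {}, which has dimension -1. *)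
definition cx_dim :: "'v set set \<Rightarrow> int" where
  "cx_dim K = int (Max (insert 0 (card ` K))) - 1"

(* Points in barycentric coordinates: a point lies in the open simplex spanned by its support.
   The topology is the one induced by the product topology on functions; as K is finite, only
   finitely many coordinates are not identically 0, and this is the usual Euclidean topology. *)
definition geom_realization :: "'v set set \<Rightarrow> ('v \<Rightarrow> real) set" where
  "geom_realization K =
     {x. (\<forall>v. 0 \<le> x v) \<and> {v. x v \<noteq> 0} \<in> K \<and> (\<Sum>v | x v \<noteq> 0. x v) = 1}"

definition flag_cx :: "'v set set \<Rightarrow> bool" where
  "flag_cx K \<longleftrightarrow>
     (\<forall>S. S \<subseteq> cx_vertices K \<and> S \<noteq> {} \<and> pairwise (cx_adj K) S \<longrightarrow> S \<in> K)"

(* A colouring of the vertices by 1, ..., m; it need not be surjective. *)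
definition cx_colouring :: "nat \<Rightarrow> 'v set set \<Rightarrow> ('v \<Rightarrow> nat) \<Rightarrow> bool" where
  "cx_colouring m K c \<longleftrightarrow>
     (\<forall>v\<in>cx_vertices K. c v \<in> {1..m}) \<and> (\<forall>u v. cx_adj K u v \<longrightarrow> c u \<noteq> c v)"

(* The cycle is (v 0, v 1, v 2, v 3), with indices mod 4. *)
definition cx_square :: "'v set set \<Rightarrow> (nat \<Rightarrow> 'v) \<Rightarrow> bool" where
  "cx_square K v \<longleftrightarrow>
     inj_on v {..<4} \<and> (\<forall>i<4. cx_adj K (v i) (v (Suc i mod 4)))"

definition flat_square :: "'v set set \<Rightarrow> (nat \<Rightarrow> 'v) \<Rightarrow> bool" where
  "flat_square K v \<longleftrightarrow>
     cx_square K v \<and> \<not> cx_adj K (v 0) (v 2) \<and> \<not> cx_adj K (v 1) (v 3)"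

definition has_flat_square_with_colours ::
  "'v set set \<Rightarrow> ('v \<Rightarrow> nat) \<Rightarrow> nat \<Rightarrow> nat \<Rightarrow> bool" where
  "has_flat_square_with_colours K c k l \<longleftrightarrow>
     (\<exists>v. flat_square K v \<and> (\<exists>i<4. {c (v i), c (v (Suc i mod 4))} = {k, l}))"

definition five_large_against ::
  "'v set set \<Rightarrow> ('v \<Rightarrow> nat) \<Rightarrow> 'w set set \<Rightarrow> ('w \<Rightarrow> nat) \<Rightarrow> bool" where
  "five_large_against K c L d \<longleftrightarrow>
     (\<forall>v. flat_square K v \<longrightarrow>
        (\<exists>j<4. \<not> has_flat_square_with_colours L d (c (v j)) (c (v (Suc j mod 4)))))"

definition pairwise_5_large ::
  "nat \<Rightarrow> 'v set set \<Rightarrow> ('v \<Rightarrow> nat) \<Rightarrow> 'w set set \<Rightarrow> ('w \<Rightarrow> nat) \<Rightarrow> bool" where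
  "pairwise_5_large m K c L d \<longleftrightarrow>
     simplicial_cx K \<and> flag_cx K \<and> cx_colouring m K c \<and>
     simplicial_cx L \<and> flag_cx L \<and> cx_colouring m L d \<and>
     five_large_against K c L d \<and> five_large_against L d K c"

end

(* Both complexes are taken to be barycentric subdivisions. In a flat square of a barycentric
   subdivision the comparabilities alternate, A, C < B, D, so A \<union> C \<subseteq> B \<inter> D with A, C and B, D
   incomparable, and the sizes of adjacent simplices differ by at least 2. Colouring by size,
   the colour pairs on the edges of flat squares thus lie in {13, 14, 24}. This is a path on
   four vertices, which is isomorphic to its complement: a permutation of the colours of the second
   complex makes the two sets of colour pairs disjoint. *)

theory Submission
  imports Defs
begin

section \<open>Compactness of geometric realizations\<close>

text \<open>A continuous injection from a compact space into a Hausdorff space is closed onto its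
  image. For arbitrary \<open>'v\<close> the function space need not be metrizable, so the Hausdorff
  property is taken from the product topology.\<close>

lemma homeomorphic_image_of_compact:
  fixes f :: "'a::topological_space \<Rightarrow> 'v \<Rightarrow> 'b::metric_space"
  assumes "compact S" "continuous_on S f" "inj_on f S"
  shows "S homeomorphic f ` S"
proof -
  have "Hausdorff_space (euclidean :: ('v \<Rightarrow> 'b) topology)"
    using Hausdorff_space_product_topology[of "\<lambda>_::'v. euclidean :: 'b topology" UNIV]
    by (simp add: euclidean_product_topology)
  then have "Hausdorff_space (top_of_set (f ` S))"
    by (rule Hausdorff_space_subtopology)
  moreover have "compact_space (top_of_set S)"
    using assms(1) by (simp add: compact_space_subtopology)
  moreover have "continuous_map (top_of_set S) (top_of_set (f ` S)) f"
    using assms(2) by auto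
  ultimately have "homeomorphic_map (top_of_set S) (top_of_set (f ` S)) f"
    using assms(3) by (intro continuous_imp_homeomorphic_map) auto
  then obtain g where "homeomorphic_maps (top_of_set S) (top_of_set (f ` S)) f g"
    unfolding homeomorphic_map_maps by blast
  then have "homeomorphism S (f ` S) f g"
    unfolding homeomorphic_maps_def homeomorphism_def by (force simp: image_iff)
  then show ?thesis
    unfolding homeomorphic_def by blast
qed

lemma simplicial_cxD:
  assumes "simplicial_cx K"
  shows "finite K" "S \<in> K \<Longrightarrow> finite S" "S \<in> K \<Longrightarrow> S \<noteq> {}"
    "S \<in> K \<Longrightarrow> T \<subseteq> S \<Longrightarrow> T \<noteq> {} \<Longrightarrow> T \<in> K"
  using assms unfolding simplicial_cx_def by blast+

text \<open>Passing from open to closed simplices prepares the compactness proof. Nothing new is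
  added: coordinates summing to 1 have nonempty support, so a support inside \<open>S\<close> is a
  face of \<open>S\<close>.\<close>

lemma geom_realization_eq_Union_simplices:
  assumes "simplicial_cx K"
  shows "geom_realization K =
    (\<Union>S\<in>K. {x. (\<forall>v. 0 \<le> x v) \<and> (\<forall>v. v \<notin> S \<longrightarrow> x v = 0) \<and> (\<Sum>v\<in>S. x v) = 1})"
proof (intro set_eqI iffI)
  fix x :: "'a \<Rightarrow> real"
  assume "x \<in> geom_realization K"
  then show "x \<in> (\<Union>S\<in>K. {x. (\<forall>v. 0 \<le> x v) \<and> (\<forall>v. v \<notin> S \<longrightarrow> x v = 0) \<and> (\<Sum>v\<in>S. x v) = 1})"
    unfolding geom_realization_def by (auto intro!: bexI[of _ "{v. x v \<noteq> 0}"])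
next
  fix x :: "'a \<Rightarrow> real"
  assume "x \<in> (\<Union>S\<in>K. {x. (\<forall>v. 0 \<le> x v) \<and> (\<forall>v. v \<notin> S \<longrightarrow> x v = 0) \<and> (\<Sum>v\<in>S. x v) = 1})"
  then obtain S where S: "S \<in> K" "\<forall>v. 0 \<le> x v" "\<forall>v. v \<notin> S \<longrightarrow> x v = 0" "(\<Sum>v\<in>S. x v) = 1"
    by auto
  have sub: "{v. x v \<noteq> 0} \<subseteq> S"
    using S(3) by auto
  then have sum1: "(\<Sum>v | x v \<noteq> 0. x v) = 1"
    unfolding S(4)[symmetric] using simplicial_cxD(2)[OF assms S(1)]
    by (intro sum.mono_neutral_left) auto
  then have "{v. x v \<noteq> 0} \<noteq> {}"
    by (metis sum.empty zero_neq_one)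
  then have "{v. x v \<noteq> 0} \<in> K"
    using simplicial_cxD(4)[OF assms S(1) sub] by blast
  then show "x \<in> geom_realization K"
    using S(2) sum1 unfolding geom_realization_def by blast
qed

lemma compact_geom_realization:
  assumes "simplicial_cx K"
  shows "compact (geom_realization K)"
  unfolding geom_realization_eq_Union_simplices[OF assms]
proof (intro compact_UN simplicial_cxD(1)[OF assms] ballI)
  fix S
  assume "S \<in> K"
  let ?T = "{x. (\<forall>v. 0 \<le> x v) \<and> (\<forall>v. v \<notin> S \<longrightarrow> x v = 0) \<and> (\<Sum>v\<in>S. x v) = (1::real)}"
  \<comment> \<open>By Tychonoff this box is compact: coordinates outside \<open>S\<close> are
    pinned to 0. The closed simplex is its intersection with the closed set where the coordinates
    over \<open>S\<close> sum to 1.\<close>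
  let ?B = "Pi\<^sub>E UNIV (\<lambda>v. if v \<in> S then {0..1::real} else {0})"
  have fin: "finite S"
    using simplicial_cxD(2)[OF assms \<open>S \<in> K\<close>] .
  have "compactin (product_topology (\<lambda>i. euclidean) UNIV) ?B"
    by (subst compactin_PiE) auto
  then have "compact ?B"
    by (simp add: euclidean_product_topology)
  moreover have "closed {x. (\<Sum>v\<in>S. x v) = (1::real)}"
    by (intro closed_Collect_eq continuous_on_sum) auto
  ultimately have "compact (?B \<inter> {x. (\<Sum>v\<in>S. x v) = 1})"
    by (rule compact_Int_closed)
  moreover have "?B \<inter> {x. (\<Sum>v\<in>S. x v) = 1} = ?T"
  proof (intro set_eqI iffI)
    fix x
    assume x: "x \<in> ?T"
    have "x v \<le> 1" if "v \<in> S" for v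
      using member_le_sum[OF that, of x] x fin by auto
    then show "x \<in> ?B \<inter> {x. (\<Sum>v\<in>S. x v) = 1}"
      using x by (auto simp: PiE_iff)
  next
    fix x
    assume x: "x \<in> ?B \<inter> {x. (\<Sum>v\<in>S. x v) = 1}"
    then have "x v \<in> (if v \<in> S then {0..1} else {0})" for v
      by (auto simp: PiE_iff)
    then have "0 \<le> x v \<and> (v \<notin> S \<longrightarrow> x v = 0)" for v
      by (smt (verit) atLeastAtMost_iff singletonD)
    then show "x \<in> ?T"
      using x by auto
  qed
  ultimately show "compact ?T"
    by simp
qed

section \<open>Decomposition of functions along chains of sets\<close>

text \<open>A nonnegative function \<open>x\<close> of finite support is uniquely a positive combination \<open>z\<close> of indicator
  functions of a chain of sets, namely of its superlevel sets. For barycentric coordinates, the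
  chain is the simplex of the barycentric subdivision containing \<open>x\<close>.\<close>

definition layers :: "('v \<Rightarrow> real) \<Rightarrow> ('v set \<Rightarrow> real) \<Rightarrow> bool" where
  "layers x z \<longleftrightarrow> (\<forall>S. 0 \<le> z S) \<and> finite {S. z S \<noteq> 0} \<and> chain\<^sub>\<subseteq> {S. z S \<noteq> 0} \<and>
     z {} = 0 \<and> (\<forall>v. x v = (\<Sum>S | z S \<noteq> 0 \<and> v \<in> S. z S))"

text \<open>Nonnegative weights cannot cancel. For a nonempty chain the union is its largest member,
  so the support of \<open>x\<close> is the top layer.\<close>

lemma layers_support:
  assumes "layers x z"
  shows "{v. x v \<noteq> 0} = \<Union>{S. z S \<noteq> 0}"
proof -
  have fin: "finite {S. z S \<noteq> 0}" and nn: "\<forall>S. 0 \<le> z S"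
    and x: "x v = (\<Sum>S | z S \<noteq> 0 \<and> v \<in> S. z S)" for v
    using assms by (auto simp: layers_def)
  have "finite {S. z S \<noteq> 0 \<and> v \<in> S}" for v
    using fin by (rule rev_finite_subset) auto
  then have "x v \<noteq> 0 \<longleftrightarrow> (\<exists>S. z S \<noteq> 0 \<and> v \<in> S)" for v
    unfolding x using nn by (subst sum_nonneg_eq_0_iff) auto
  then show ?thesis
    by auto
qed

lemma Union_chain_subset_mem:
  assumes "finite C" "C \<noteq> {}" "chain\<^sub>\<subseteq> C"
  shows "\<Union>C \<in> C"
  using Union_in_chain[OF assms(1,2)] assms(3) by (simp add: chain_subset_alt_def)

text \<open>The weight of the top layer is forced: some point of \<open>M\<close> lies in no smaller
  layer, so \<open>x\<close> equals \<open>z M\<close> there, and \<open>x\<close> is at least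
  \<open>z M\<close> on all of \<open>M\<close>.\<close>

lemma layers_peel:
  assumes z: "layers x z" and M: "M = {v. x v \<noteq> 0}" "M \<noteq> {}" "finite M"
  shows "z M = Min (x ` M)" "layers (\<lambda>v. x v - (if v \<in> M then Min (x ` M) else 0)) (z(M := 0))"
proof -
  let ?C = "{S. z S \<noteq> 0}"
  have fin: "finite ?C" and nn: "0 \<le> z S" and chain: "chain\<^sub>\<subseteq> ?C" and ne: "z {} = 0"
    and x: "x v = (\<Sum>S | z S \<noteq> 0 \<and> v \<in> S. z S)" for S v
    using z by (auto simp: layers_def)
  have fin': "finite {S. z S \<noteq> 0 \<and> v \<in> S}" for v
    using fin by (rule rev_finite_subset) auto
  have MC: "M = \<Union>?C"
    using layers_support[OF z] M by simp
  then have "?C \<noteq> {}"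
    using M(2) by auto
  then have "M \<in> ?C"
    using Union_chain_subset_mem[OF fin _ chain] MC by metis
  \<comment> \<open>The union of the smaller layers is empty or itself one of them, so it leaves a
    point of \<open>M\<close> uncovered.\<close>
  have "\<Union>(?C - {M}) \<noteq> M"
  proof (cases "?C - {M} = {}")
    case True
    then show ?thesis
      using M(2) by (metis Sup_empty)
  next
    case False
    moreover have "chain\<^sub>\<subseteq> (?C - {M})"
      using chain unfolding chain_subset_def by blast
    ultimately have "\<Union>(?C - {M}) \<in> ?C - {M}"
      using fin by (intro Union_chain_subset_mem) auto
    then show ?thesis
      by blast
  qed
  moreover have "\<Union>(?C - {M}) \<subseteq> M"
    using MC by blast
  ultimately obtain w where w: "w \<in> M" "w \<notin> \<Union>(?C - {M})"
    by blast
  then have "{S. z S \<noteq> 0 \<and> w \<in> S} = {M}"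
    using \<open>M \<in> ?C\<close> by auto
  then have "x w = z M"
    by (simp add: x)
  moreover have "z M \<le> x u" if "u \<in> M" for u
    unfolding x using that \<open>M \<in> ?C\<close> fin' nn by (intro member_le_sum) auto
  ultimately show zM: "z M = Min (x ` M)"
    using w(1) M(3) by (intro Min_eqI[symmetric]) (auto intro: rev_image_eqI)
  have "x v - (if v \<in> M then z M else 0) = (\<Sum>S | (z(M := 0)) S \<noteq> 0 \<and> v \<in> S. (z(M := 0)) S)" for v
  proof -
    have "{S. (z(M := 0)) S \<noteq> 0 \<and> v \<in> S} = {S. z S \<noteq> 0 \<and> v \<in> S} - {M}"
      by auto
    then have "(\<Sum>S | (z(M := 0)) S \<noteq> 0 \<and> v \<in> S. (z(M := 0)) S)
        = (\<Sum>S\<in>{S. z S \<noteq> 0 \<and> v \<in> S} - {M}. z S)"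
      by (intro sum.cong) simp_all
    also have "\<dots> = x v - (if v \<in> M then z M else 0)"
      using \<open>M \<in> ?C\<close> by (simp add: x sum_diff1 fin')
    finally show ?thesis ..
  qed
  moreover have "finite {S. (z(M := 0)) S \<noteq> 0}"
    using fin by (rule rev_finite_subset) auto
  moreover have "chain\<^sub>\<subseteq> {S. (z(M := 0)) S \<noteq> 0}"
    using chain unfolding chain_subset_def by auto
  ultimately show "layers (\<lambda>v. x v - (if v \<in> M then Min (x ` M) else 0)) (z(M := 0))"
    unfolding layers_def zM[symmetric] using nn ne by auto
qed

text \<open>Converse of peeling: a set containing all layers can be put on top of the chain with any
  nonnegative weight.\<close>

lemma layers_unpeel:
  assumes z: "layers (\<lambda>v. x v - (if v \<in> M then m else 0)) z"
    and M: "M \<noteq> {}" "z M = 0" "0 \<le> m" "\<And>S. z S \<noteq> 0 \<Longrightarrow> S \<subseteq> M"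
  shows "layers x (z(M := m))"
proof (cases "m = 0")
  \<comment> \<open>A layer of weight 0 does not enter the support, so this case is separate from
    the one where \<open>M\<close> is inserted.\<close>
  case True
  have "z(M := 0) = z"
    using M(2) by auto
  moreover have "(\<lambda>v. x v - (if v \<in> M then m else 0)) = x"
    using True by auto
  ultimately show ?thesis
    using z True by simp
next
  case False
  have fin: "finite {S. z S \<noteq> 0}" and nn: "0 \<le> z S" and chain: "chain\<^sub>\<subseteq> {S. z S \<noteq> 0}" and ne: "z {} = 0"
    and x: "x v - (if v \<in> M then m else 0) = (\<Sum>S | z S \<noteq> 0 \<and> v \<in> S. z S)" for S v
    using z unfolding layers_def by blast+
  have fin': "finite {S. z S \<noteq> 0 \<and> v \<in> S}" for v
    using fin by (rule rev_finite_subset) auto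
  have supp: "{S. (z(M := m)) S \<noteq> 0} = insert M {S. z S \<noteq> 0}"
    using False by auto
  have "x v = (\<Sum>S | (z(M := m)) S \<noteq> 0 \<and> v \<in> S. (z(M := m)) S)" for v
  proof (cases "v \<in> M")
    case True
    then have "{S. (z(M := m)) S \<noteq> 0 \<and> v \<in> S} = insert M {S. z S \<noteq> 0 \<and> v \<in> S}"
      using False by auto
    moreover have "(\<Sum>S | z S \<noteq> 0 \<and> v \<in> S. (z(M := m)) S) = (\<Sum>S | z S \<noteq> 0 \<and> v \<in> S. z S)"
      using M(2) by (intro sum.cong) auto
    ultimately show ?thesis
      using fin' M(2) x[of v] True by simp
  next
    case False
    then have "(\<Sum>S | (z(M := m)) S \<noteq> 0 \<and> v \<in> S. (z(M := m)) S) = (\<Sum>S | z S \<noteq> 0 \<and> v \<in> S. z S)"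
      by (intro sum.cong) auto
    then show ?thesis
      using x[of v] False by simp
  qed
  moreover have "chain\<^sub>\<subseteq> (insert M {S. z S \<noteq> 0})"
    using chain M(4) unfolding chain_subset_def by blast
  ultimately show ?thesis
    unfolding layers_def supp using fin nn ne M(1,3) by auto
qed

text \<open>A point where the minimum is attained drops out. This makes the inductions on the size
  of the support terminate.\<close>

lemma support_peel_psubset:
  fixes x :: "'v \<Rightarrow> real"
  assumes "M = {v. x v \<noteq> 0}" "finite M" "M \<noteq> {}"
  shows "{v. x v - (if v \<in> M then Min (x ` M) else 0) \<noteq> 0} \<subset> M"
proof -
  have "Min (x ` M) \<in> x ` M"
    using assms(2,3) by (intro Min_in) simp_all
  then obtain w where w: "w \<in> M" "x w = Min (x ` M)"
    by auto
  have "{v. x v - (if v \<in> M then Min (x ` M) else 0) \<noteq> 0} \<subseteq> M - {w}"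
    using w(2) unfolding assms(1) by auto
  then show ?thesis
    using w(1) by blast
qed

text \<open>Greedy construction: subtract the minimum of \<open>x\<close> on its support, decompose
  the rest by induction, and add the support back as top layer.\<close>

lemma layers_exists:
  assumes "finite {v. x v \<noteq> 0}" "\<And>v. 0 \<le> x v"
  shows "\<exists>z. layers x z"
  using assms
proof (induction "card {v. x v \<noteq> 0}" arbitrary: x rule: less_induct)
  case less
  define M where "M = {v. x v \<noteq> 0}"
  let ?m = "Min (x ` M)"
  let ?x = "\<lambda>v. x v - (if v \<in> M then ?m else 0)"
  show ?case
  proof (cases "M = {}")
    case True
    then have "layers x (\<lambda>_. 0)"
      by (auto simp: layers_def M_def chain_subset_def)
    then show ?thesis
      by blast
  next
    case False
    have fin: "finite M"
      using less M_def by simp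
    have sub: "{v. ?x v \<noteq> 0} \<subset> M"
      using support_peel_psubset[OF M_def fin False] .
    then have "card {v. ?x v \<noteq> 0} < card {v. x v \<noteq> 0}"
      using fin psubset_card_mono M_def by metis
    moreover have "finite {v. ?x v \<noteq> 0}"
      using sub fin finite_subset by blast
    moreover have "0 \<le> ?x v" for v
      using fin less.prems(2) by (auto intro: Min_le)
    ultimately have "\<exists>z. layers ?x z"
      by (rule less.hyps)
    then obtain z where z: "layers ?x z" ..
    \<comment> \<open>Strictness gives \<open>z M = 0\<close>, so \<open>M\<close> is a new layer
      and the weight \<open>?m\<close> overwrites nothing.\<close>
    have supp: "S \<subset> M" if "z S \<noteq> 0" for S
      using layers_support[OF z] sub that by blast
    have "0 \<le> ?m"
      using False fin less.prems(2) by simp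
    then have "layers x (z(M := ?m))"
      using layers_unpeel[OF z False] supp by blast
    then show ?thesis
      by blast
  qed
qed

text \<open>Peeling determines the weight of the top layer from \<open>x\<close>, and the induction
  hypothesis the others. In the base case only \<open>{}\<close> could be a layer, which
  \<open>z {} = 0\<close> excludes.\<close>

lemma layers_unique:
  assumes "finite {v. x v \<noteq> 0}" "layers x z" "layers x z'"
  shows "z = z'"
  using assms
proof (induction "card {v. x v \<noteq> 0}" arbitrary: x z z' rule: less_induct)
  case less
  define M where "M = {v. x v \<noteq> 0}"
  let ?x = "\<lambda>v. x v - (if v \<in> M then Min (x ` M) else 0)"
  show ?case
  proof (cases "M = {}")
    case True
    have zero: "z S = 0" if "layers x z" for z S
    proof (rule ccontr)
      assume "z S \<noteq> 0"
      moreover have "\<Union>{S. z S \<noteq> 0} = {}"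
        using layers_support[OF that] True M_def by simp
      ultimately have "S = {}"
        by blast
      then show False
        using that \<open>z S \<noteq> 0\<close> by (simp add: layers_def)
    qed
    then show ?thesis
      using zero[OF less.prems(2)] zero[OF less.prems(3)] by auto
  next
    case False
    have fin: "finite M"
      using less M_def by simp
    have sub: "{v. ?x v \<noteq> 0} \<subset> M"
      using support_peel_psubset[OF M_def fin False] .
    then have "card {v. ?x v \<noteq> 0} < card {v. x v \<noteq> 0}"
      using fin psubset_card_mono M_def by metis
    moreover have "finite {v. ?x v \<noteq> 0}"
      using sub fin finite_subset by blast
    ultimately have "z(M := 0) = z'(M := 0)"
      by (rule less.hyps) (intro layers_peel(2)[OF _ M_def False fin] less.prems(2,3))+
    moreover have "z M = z' M"
      using layers_peel(1)[OF _ M_def False fin] less.prems(2,3) by metis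
    ultimately show ?thesis
      by (metis fun_upd_triv fun_upd_upd)
  qed
qed

text \<open>Double counting of pairs \<open>v \<in> S\<close>. With weights of the form coordinate
  over cardinality, this shows that total mass is preserved under subdivision.\<close>

lemma layers_sum:
  assumes z: "layers x z" and K: "finite K" "\<And>S. S \<in> K \<Longrightarrow> finite S" "{S. z S \<noteq> 0} \<subseteq> K"
  shows "(\<Sum>v | x v \<noteq> 0. x v) = (\<Sum>S\<in>K. real (card S) * z S)"
proof -
  have x: "x v = (\<Sum>S | S \<in> K \<and> v \<in> S. z S)" for v
  proof -
    have "x v = (\<Sum>S | z S \<noteq> 0 \<and> v \<in> S. z S)"
      using z by (simp add: layers_def)
    also have "\<dots> = (\<Sum>S | S \<in> K \<and> v \<in> S. z S)"
      using K by (intro sum.mono_neutral_left) auto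
    finally show ?thesis .
  qed
  have fin: "finite (\<Union>K)"
    using K by auto
  have "{v. x v \<noteq> 0} \<subseteq> \<Union>K"
    using layers_support[OF z] K(3) by auto
  then have "(\<Sum>v | x v \<noteq> 0. x v) = (\<Sum>v\<in>\<Union>K. x v)"
    using fin by (intro sum.mono_neutral_left) auto
  also have "\<dots> = (\<Sum>S\<in>K. \<Sum>v | v \<in> \<Union>K \<and> v \<in> S. z S)"
    unfolding x using sum.swap_restrict[OF fin K(1), of "\<lambda>_ S. z S"] by simp
  also have "\<dots> = (\<Sum>S\<in>K. real (card S) * z S)"
  proof (intro sum.cong refl)
    fix S
    assume "S \<in> K"
    then have "{v. v \<in> \<Union>K \<and> v \<in> S} = S"
      by auto
    then show "(\<Sum>v | v \<in> \<Union>K \<and> v \<in> S. z S) = real (card S) * z S"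
      by simp
  qed
  finally show ?thesis .
qed

section \<open>Combinatorics of the barycentric subdivision\<close>

text \<open>This is the order complex of the face poset with vertices renamed by \<open>f\<close>;
  an injective \<open>f\<close> lets the subdivision live on another vertex type, such as the
  naturals.\<close>

definition barycentric_subdivision :: "('v set \<Rightarrow> 'l) \<Rightarrow> 'v set set \<Rightarrow> 'l set set" where
  "barycentric_subdivision f K = {f ` C |C. C \<noteq> {} \<and> C \<subseteq> K \<and> chain\<^sub>\<subseteq> C}"

lemma simplicial_barycentric_subdivision:
  assumes "simplicial_cx K"
  shows "simplicial_cx (barycentric_subdivision f K)"
  unfolding simplicial_cx_def
proof (intro conjI ballI allI impI)
  have "barycentric_subdivision f K \<subseteq> (\<lambda>C. f ` C) ` Pow K"
    unfolding barycentric_subdivision_def by auto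
  then show "finite (barycentric_subdivision f K)"
    using simplicial_cxD(1)[OF assms] by (auto intro: finite_subset)
next
  fix D
  assume "D \<in> barycentric_subdivision f K"
  then obtain C where C: "D = f ` C" "C \<noteq> {}" "C \<subseteq> K" "chain\<^sub>\<subseteq> C"
    by (auto simp: barycentric_subdivision_def)
  show "finite D" "D \<noteq> {}"
    using C simplicial_cxD(1)[OF assms] finite_subset by auto
  fix E
  assume E: "E \<subseteq> D \<and> E \<noteq> {}"
  then obtain C' where "C' \<subseteq> C" "E = f ` C'"
    using C(1) by (metis subset_imageE)
  moreover have "chain\<^sub>\<subseteq> C'"
    using C(4) \<open>C' \<subseteq> C\<close> unfolding chain_subset_def by blast
  ultimately show "E \<in> barycentric_subdivision f K"
    unfolding barycentric_subdivision_def using C(3) E by blast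
qed

lemma cx_vertices_barycentric_subdivision:
  "cx_vertices (barycentric_subdivision f K) = f ` K"
proof (intro set_eqI iffI)
  fix a
  assume "a \<in> f ` K"
  then obtain S where "S \<in> K" "a = f S"
    by auto
  then have "{a} = f ` {S} \<and> {S} \<noteq> {} \<and> {S} \<subseteq> K \<and> chain\<^sub>\<subseteq> {S}"
    by (auto simp: chain_subset_def)
  then show "a \<in> cx_vertices (barycentric_subdivision f K)"
    unfolding cx_vertices_def barycentric_subdivision_def by blast
next
  fix a
  assume "a \<in> cx_vertices (barycentric_subdivision f K)"
  then show "a \<in> f ` K"
    unfolding cx_vertices_def barycentric_subdivision_def by blast
qed

lemma cx_adj_barycentric_subdivision:
  assumes "inj_on f K"
  shows "cx_adj (barycentric_subdivision f K) a b \<longleftrightarrow>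
    (\<exists>S\<in>K. \<exists>T\<in>K. a = f S \<and> b = f T \<and> S \<noteq> T \<and> (S \<subseteq> T \<or> T \<subseteq> S))"
proof
  assume "cx_adj (barycentric_subdivision f K) a b"
  then obtain C where C: "a \<noteq> b" "{a, b} = f ` C" "C \<subseteq> K" "chain\<^sub>\<subseteq> C"
    unfolding cx_adj_def barycentric_subdivision_def by blast
  then obtain S T where "S \<in> C" "T \<in> C" "a = f S" "b = f T"
    by (metis image_iff insertCI)
  then show "\<exists>S\<in>K. \<exists>T\<in>K. a = f S \<and> b = f T \<and> S \<noteq> T \<and> (S \<subseteq> T \<or> T \<subseteq> S)"
    using C unfolding chain_subset_def by blast
next
  assume "\<exists>S\<in>K. \<exists>T\<in>K. a = f S \<and> b = f T \<and> S \<noteq> T \<and> (S \<subseteq> T \<or> T \<subseteq> S)"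
  then obtain S T where ST: "S \<in> K" "T \<in> K" "a = f S" "b = f T" "S \<noteq> T" "S \<subseteq> T \<or> T \<subseteq> S"
    by blast
  then have "{a, b} = f ` {S, T} \<and> {S, T} \<noteq> {} \<and> {S, T} \<subseteq> K \<and> chain\<^sub>\<subseteq> {S, T}"
    by (auto simp: chain_subset_def)
  then have "{a, b} \<in> barycentric_subdivision f K"
    unfolding barycentric_subdivision_def by blast
  then show "cx_adj (barycentric_subdivision f K) a b"
    using ST assms by (auto simp: cx_adj_def inj_on_def)
qed

text \<open>Adjacency is comparability under inclusion, and pairwise comparable simplices form a
  chain.\<close>

lemma flag_barycentric_subdivision:
  assumes "inj_on f K"
  shows "flag_cx (barycentric_subdivision f K)"
  unfolding flag_cx_def cx_vertices_barycentric_subdivision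
proof (intro allI impI, elim conjE)
  fix D
  assume D: "D \<subseteq> f ` K" "D \<noteq> {}" "pairwise (cx_adj (barycentric_subdivision f K)) D"
  then obtain C where C: "C \<subseteq> K" "D = f ` C"
    by (metis subset_imageE)
  have "S \<subseteq> T \<or> T \<subseteq> S" if "S \<in> C" "T \<in> C" for S T
  proof (cases "S = T")
    case False
    then have "f S \<noteq> f T"
      using that C(1) assms by (meson inj_on_eq_iff subsetD)
    then have "cx_adj (barycentric_subdivision f K) (f S) (f T)"
      using D(3) C(2) that by (simp add: pairwise_def)
    then obtain S' T' where "S' \<in> K" "T' \<in> K" "f S = f S'" "f T = f T'" "S' \<subseteq> T' \<or> T' \<subseteq> S'"
      unfolding cx_adj_barycentric_subdivision[OF assms] by blast
    moreover have "S \<in> K" "T \<in> K"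
      using that C(1) by auto
    ultimately show ?thesis
      using assms by (metis inj_onD)
  qed auto
  then show "D \<in> barycentric_subdivision f K"
    unfolding barycentric_subdivision_def chain_subset_def using C D(2) by blast
qed

section \<open>The homeomorphism with the subdivision\<close>

text \<open>The map \<open>\<phi>\<close> sends the vertex \<open>f S\<close> to the barycentre of
  \<open>S\<close> and is affine on simplices. It is a continuous map on a compact space, and its
  bijectivity is existence and uniqueness of layers.\<close>

lemma homeomorphic_barycentric_subdivision:
  assumes K: "simplicial_cx K" and f: "inj_on f K"
  shows "geom_realization (barycentric_subdivision f K) homeomorphic geom_realization K"
proof -
  let ?sd = "barycentric_subdivision f K"
  \<comment> \<open>The barycentre of \<open>S\<close> is the indicator of \<open>S\<close> divided
    by \<open>card S\<close>, so \<open>z y\<close> is the candidate layering of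
    \<open>\<phi> y\<close>.\<close>
  define z where "z y S = (if S \<in> K then y (f S) / real (card S) else 0)" for y S
  define \<phi> where "\<phi> y v = (\<Sum>S | S \<in> K \<and> v \<in> S. y (f S) / real (card S))" for y v
  have card: "real (card S) \<noteq> 0" if "S \<in> K" for S
    using simplicial_cxD(2,3)[OF K that] by simp
  have zK: "{S. z y S \<noteq> 0} \<subseteq> K" for y
    by (auto simp: z_def)
  have layers: "layers (\<phi> y) (z y)"
    if nn: "\<And>a. 0 \<le> y a" and chain: "chain\<^sub>\<subseteq> {S. z y S \<noteq> 0}" for y
    unfolding layers_def
  proof (intro conjI allI chain)
    show "0 \<le> z y S" for S
      using nn by (simp add: z_def)
    show "finite {S. z y S \<noteq> 0}"
      using zK simplicial_cxD(1)[OF K] by (rule finite_subset)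
    show "z y {} = 0"
      by (simp add: z_def)
    have "(\<Sum>S | z y S \<noteq> 0 \<and> v \<in> S. z y S) = (\<Sum>S | S \<in> K \<and> v \<in> S. z y S)" for v
      using zK[of y] simplicial_cxD(1)[OF K] by (intro sum.mono_neutral_left) auto
    then show "\<phi> y v = (\<Sum>S | z y S \<noteq> 0 \<and> v \<in> S. z y S)" for v
      by (simp add: \<phi>_def z_def)
  qed
  have supp: "{a. y a \<noteq> 0} = f ` {S. z y S \<noteq> 0}" if "{a. y a \<noteq> 0} \<subseteq> f ` K" for y
    using that card by (force simp: z_def)
  have sum: "(\<Sum>a | y a \<noteq> 0. y a) = (\<Sum>v | \<phi> y v \<noteq> 0. \<phi> y v)"
    if "{a. y a \<noteq> 0} \<subseteq> f ` K" "layers (\<phi> y) (z y)" for y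
  proof -
    have "(\<Sum>v | \<phi> y v \<noteq> 0. \<phi> y v) = (\<Sum>S\<in>K. real (card S) * z y S)"
      using simplicial_cxD(1,2)[OF K] zK by (intro layers_sum[OF that(2)]) auto
    also have "\<dots> = (\<Sum>S\<in>K. y (f S))"
      using card by (intro sum.cong) (auto simp: z_def)
    also have "\<dots> = (\<Sum>a\<in>f ` K. y a)"
      by (simp add: sum.reindex f)
    also have "\<dots> = (\<Sum>a | y a \<noteq> 0. y a)"
      using that(1) simplicial_cxD(1)[OF K] by (intro sum.mono_neutral_right) auto
    finally show ?thesis ..
  qed
  have sdD: "\<And>a. 0 \<le> y a" "{a. y a \<noteq> 0} \<subseteq> f ` K" "layers (\<phi> y) (z y)" "\<phi> y \<in> geom_realization K"
    if y: "y \<in> geom_realization ?sd" for y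
  proof -
    show nn: "\<And>a. 0 \<le> y a"
      using y by (auto simp: geom_realization_def)
    obtain C where C: "{a. y a \<noteq> 0} = f ` C" "C \<noteq> {}" "C \<subseteq> K" "chain\<^sub>\<subseteq> C"
      using y by (auto simp: geom_realization_def barycentric_subdivision_def)
    show sub: "{a. y a \<noteq> 0} \<subseteq> f ` K"
      using C by auto
    have "f ` {S. z y S \<noteq> 0} = f ` C"
      using C(1) supp[OF sub] by simp
    then have zC: "{S. z y S \<noteq> 0} = C"
      using inj_on_image_eq_iff[OF f zK C(3)] by blast
    show lay: "layers (\<phi> y) (z y)"
      using layers[OF nn] C(4) zC by simp
    have "{v. \<phi> y v \<noteq> 0} = \<Union>C"
      using layers_support[OF lay] zC by simp
    moreover have "\<Union>C \<in> K"
      using Union_chain_subset_mem[OF _ C(2,4)] C(3) simplicial_cxD(1)[OF K] finite_subset by blast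
    moreover have "0 \<le> \<phi> y v" for v
      unfolding \<phi>_def by (intro sum_nonneg) (simp add: nn)
    moreover have "(\<Sum>v | \<phi> y v \<noteq> 0. \<phi> y v) = 1"
      using sum[OF sub lay] y by (simp add: geom_realization_def)
    ultimately show "\<phi> y \<in> geom_realization K"
      by (simp add: geom_realization_def)
  qed
  have fin: "finite {v. x v \<noteq> 0}" if "x \<in> geom_realization K" for x
    using that simplicial_cxD(2)[OF K] by (simp add: geom_realization_def)
  have "continuous_on (geom_realization ?sd) \<phi>"
    unfolding \<phi>_def
    by (intro continuous_on_coordinatewise_then_product continuous_on_sum continuous_on_divide
        continuous_on_subset[OF continuous_on_product_coordinates]) (use card in auto)
  moreover have "inj_on \<phi> (geom_realization ?sd)"
  proof (rule inj_onI)
    \<comment> \<open>Equal images have equal layers, which fix the coordinates at all labels; at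
      other points both functions vanish.\<close>
    fix y y'
    assume y: "y \<in> geom_realization ?sd" "y' \<in> geom_realization ?sd" "\<phi> y = \<phi> y'"
    then have "z y = z y'"
      using layers_unique[OF fin] sdD(3,4) by metis
    show "y = y'"
    proof
      fix a
      show "y a = y' a"
      proof (cases "a \<in> f ` K")
        case True
        then obtain S where "S \<in> K" "a = f S"
          by auto
        then show ?thesis
          using fun_cong[OF \<open>z y = z y'\<close>, of S] card[of S] by (auto simp: z_def)
      next
        case False
        then show ?thesis
          using sdD(2)[OF y(1)] sdD(2)[OF y(2)] by (metis (mono_tags, lifting) mem_Collect_eq subsetD)
      qed
    qed
  qed
  moreover have "\<phi> ` geom_realization ?sd = geom_realization K"
  proof (intro equalityI subsetI)
    fix x
    assume x: "x \<in> geom_realization K"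
    then obtain w where w: "layers x w"
      using layers_exists[OF fin[OF x]] by (auto simp: geom_realization_def)
    \<comment> \<open>Each layer is a nonempty part of the support of \<open>x\<close>, hence a face
      of a simplex.\<close>
    have wK: "S \<in> K" if "w S \<noteq> 0" for S
    proof -
      have "S \<subseteq> {v. x v \<noteq> 0}"
        using layers_support[OF w] that by blast
      moreover have "S \<noteq> {}"
        using w that by (auto simp: layers_def)
      moreover have "{v. x v \<noteq> 0} \<in> K"
        using x by (simp add: geom_realization_def)
      ultimately show ?thesis
        using simplicial_cxD(4)[OF K] by blast
    qed
    \<comment> \<open>Preimage of \<open>x\<close>: multiplying by the cardinality undoes the
      division in \<open>z\<close>.\<close>
    define y where "y a = (if a \<in> f ` K then real (card (inv_into K f a)) * w (inv_into K f a) else 0)" for a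
    have zy: "z y = w"
    proof
      show "z y S = w S" for S
        using wK[of S] card[of S] f by (auto simp: z_def y_def)
    qed
    have nn: "0 \<le> y a" for a
      using w by (simp add: y_def layers_def)
    have chain: "chain\<^sub>\<subseteq> {S. w S \<noteq> 0}"
      using w by (simp add: layers_def)
    have lay: "layers (\<phi> y) w"
      using layers[of y] nn chain zy by simp
    have phi: "\<phi> y = x"
      using lay w unfolding layers_def by auto
    have sub: "{a. y a \<noteq> 0} \<subseteq> f ` K"
      by (auto simp: y_def)
    have "{a. y a \<noteq> 0} = f ` {S. w S \<noteq> 0}"
      using supp[OF sub] zy by simp
    moreover have "{S. w S \<noteq> 0} \<noteq> {}"
      using layers_support[OF w] x simplicial_cxD(3)[OF K] unfolding geom_realization_def by force
    ultimately have "{a. y a \<noteq> 0} \<in> ?sd"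
      unfolding barycentric_subdivision_def using chain wK by blast
    moreover have "(\<Sum>a | y a \<noteq> 0. y a) = 1"
      using sum[OF sub] lay zy phi x by (simp add: geom_realization_def)
    ultimately have "y \<in> geom_realization ?sd"
      using nn by (simp add: geom_realization_def)
    then show "x \<in> \<phi> ` geom_realization ?sd"
      using phi by blast
  qed (use sdD(4) in auto)
  ultimately show ?thesis
    using homeomorphic_image_of_compact[OF
        compact_geom_realization[OF simplicial_barycentric_subdivision[OF K]]]
    by metis
qed

section \<open>Sizes of simplices in flat squares\<close>

lemma card_le_cx_dim:
  assumes "simplicial_cx K" "S \<in> K"
  shows "int (card S) \<le> cx_dim K + 1"
proof -
  have "card S \<le> Max (insert 0 (card ` K))"
    using simplicial_cxD(1)[OF assms(1)] assms(2) by (intro Max_ge) auto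
  then show ?thesis
    by (simp add: cx_dim_def)
qed

text \<open>A point of \<open>C\<close> outside \<open>A\<close> and a point of \<open>B\<close>
  outside \<open>D\<close> both lie in \<open>B\<close> but not in \<open>A\<close>. They differ
  because the first one lies in \<open>D\<close>.\<close>

lemma card_crossing_bound:
  assumes "A \<subseteq> B" "A \<subseteq> D" "C \<subseteq> B" "C \<subseteq> D" "\<not> C \<subseteq> A" "\<not> B \<subseteq> D" "finite B"
  shows "card A + 2 \<le> card B"
proof -
  obtain p q where "p \<in> C" "p \<notin> A" "q \<in> B" "q \<notin> D"
    using assms(5,6) by blast
  then have pq: "p \<noteq> q" "p \<notin> A" "q \<notin> A" "insert p (insert q A) \<subseteq> B"
    using assms(1-4) by blast+
  have "finite A"
    using assms(1,7) finite_subset by blast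
  then have "card A + 2 = card (insert p (insert q A))"
    using pq by simp
  then show ?thesis
    using card_mono[OF assms(7) pq(4)] by simp
qed

definition size_gap :: "nat \<Rightarrow> nat \<Rightarrow> bool" where
  "size_gap a b \<longleftrightarrow> a + 2 \<le> b \<or> b + 2 \<le> a"

text \<open>Two consecutive inclusions in the same direction would make a diagonal comparable, so
  the inclusions alternate and the crossing bound applies, with either \<open>A\<close> or
  \<open>B\<close> as the smaller set.\<close>

lemma size_gap_four_cycle:
  assumes "A \<subseteq> B \<or> B \<subseteq> A" "B \<subseteq> C \<or> C \<subseteq> B" "C \<subseteq> D \<or> D \<subseteq> C" "D \<subseteq> A \<or> A \<subseteq> D"
    and "\<not> A \<subseteq> C" "\<not> C \<subseteq> A" "\<not> B \<subseteq> D" "\<not> D \<subseteq> B"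
    and "finite A" "finite B"
  shows "size_gap (card A) (card B)"
proof (cases "A \<subseteq> B")
  case True
  then have "A \<subseteq> D" "C \<subseteq> B" "C \<subseteq> D"
    using assms by blast+
  then show ?thesis
    using card_crossing_bound[of A B D C] True assms by (auto simp: size_gap_def)
next
  case False
  then have "B \<subseteq> A" "B \<subseteq> C" "D \<subseteq> A" "D \<subseteq> C"
    using assms by blast+
  then show ?thesis
    using card_crossing_bound[of B A C D] assms by (auto simp: size_gap_def)
qed

lemma flat_square_barycentric_subdivision_size_gap:
  assumes K: "simplicial_cx K" and f: "inj_on f K"
    and v: "flat_square (barycentric_subdivision f K) v" and i: "i < 4"
  obtains S T where "S \<in> K" "T \<in> K" "v i = f S" "v (Suc i mod 4) = f T" "size_gap (card S) (card T)"
proof -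
  let ?adj = "cx_adj (barycentric_subdivision f K)"
  have adj: "?adj (v j) (v (Suc j mod 4))" if "j < 4" for j
    using v that by (simp add: flat_square_def cx_square_def)
  have inj: "inj_on v {..<4}"
    using v by (simp add: flat_square_def cx_square_def)
  have "\<exists>S\<in>K. v j = f S" if "j < 4" for j
    using adj[OF that] unfolding cx_adj_barycentric_subdivision[OF f] by blast
  then obtain s where s: "\<And>j. j < 4 \<Longrightarrow> s j \<in> K \<and> v j = f (s j)"
    by metis
  have comp: "s j \<subseteq> s k \<or> s k \<subseteq> s j" if "?adj (v j) (v k)" "j < 4" "k < 4" for j k
    using that s unfolding cx_adj_barycentric_subdivision[OF f] by (metis f inj_onD)
  \<comment> \<open>Non-adjacent vertices could still be equal; injectivity of the cycle rules this
    out.\<close>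
  have incomp: "\<not> s j \<subseteq> s k" "\<not> s k \<subseteq> s j" if "\<not> ?adj (v j) (v k)" "j < 4" "k < 4" "j \<noteq> k" for j k
  proof -
    have "v j \<noteq> v k"
      using inj that by (auto simp: inj_on_def)
    then show "\<not> s j \<subseteq> s k" "\<not> s k \<subseteq> s j"
      using that s unfolding cx_adj_barycentric_subdivision[OF f] by metis+
  qed
  have edges: "?adj (v 0) (v 1)" "?adj (v 1) (v 2)" "?adj (v 2) (v 3)" "?adj (v 3) (v 0)"
    using adj[of 0] adj[of 1] adj[of 2] adj[of 3] by (simp_all add: numeral_2_eq_2[symmetric])
  have c: "s 0 \<subseteq> s 1 \<or> s 1 \<subseteq> s 0" "s 1 \<subseteq> s 2 \<or> s 2 \<subseteq> s 1" "s 2 \<subseteq> s 3 \<or> s 3 \<subseteq> s 2" "s 3 \<subseteq> s 0 \<or> s 0 \<subseteq> s 3"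
    using comp[of 0 1] comp[of 1 2] comp[of 2 3] comp[of 3 0] edges by simp_all
  have n: "\<not> s 0 \<subseteq> s 2" "\<not> s 2 \<subseteq> s 0" "\<not> s 1 \<subseteq> s 3" "\<not> s 3 \<subseteq> s 1"
    using incomp[of 0 2] incomp[of 1 3] v by (auto simp: flat_square_def)
  have fin: "finite (s j)" if "j < 4" for j
    using s[OF that] simplicial_cxD(2)[OF K] by blast
  \<comment> \<open>One edge bound, applied to the four rotations of the cycle.\<close>
  have gap: "size_gap (card (s 0)) (card (s 1))" "size_gap (card (s 1)) (card (s 2))"
     "size_gap (card (s 2)) (card (s 3))" "size_gap (card (s 3)) (card (s 0))"
    using size_gap_four_cycle[of "s 0" "s 1" "s 2" "s 3"] size_gap_four_cycle[of "s 1" "s 2" "s 3" "s 0"]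
      size_gap_four_cycle[of "s 2" "s 3" "s 0" "s 1"] size_gap_four_cycle[of "s 3" "s 0" "s 1" "s 2"]
      c n fin by simp_all
  have "i = 0 \<or> i = 1 \<or> i = 2 \<or> i = 3"
    using i by auto
  then have "size_gap (card (s i)) (card (s (Suc i mod 4)))"
    using gap by (elim disjE) (simp_all add: numeral_2_eq_2[symmetric])
  then show ?thesis
    using that s[OF i] s[of "Suc i mod 4"] by (metis mod_less_divisor zero_less_numeral)
qed

section \<open>Colouring by size, up to a permutation of the colours\<close>

text \<open>Adjacent vertices are properly nested finite simplices, so their sizes differ, and
  \<open>p\<close> keeps distinct sizes distinct.\<close>

lemma colouring_barycentric_subdivision:
  assumes K: "simplicial_cx K" and f: "inj_on f K"
    and m: "\<And>S. S \<in> K \<Longrightarrow> card S \<le> m" and p: "inj_on p {1..m}" "p ` {1..m} \<subseteq> {1..m}"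
  shows "cx_colouring m (barycentric_subdivision f K) (\<lambda>a. p (card (inv_into K f a)))"
  unfolding cx_colouring_def cx_vertices_barycentric_subdivision
proof (intro conjI ballI allI impI)
  have size: "card S \<in> {1..m}" if "S \<in> K" for S
    using m[OF that] simplicial_cxD(2,3)[OF K that] by (simp add: Suc_le_eq card_gt_0_iff)
  show "p (card (inv_into K f a)) \<in> {1..m}" if "a \<in> f ` K" for a
    using size[OF inv_into_into[OF that]] p(2) by blast
  fix a b
  assume "cx_adj (barycentric_subdivision f K) a b"
  then obtain S T where ST: "S \<in> K" "T \<in> K" "a = f S" "b = f T" "S \<subset> T \<or> T \<subset> S"
    unfolding cx_adj_barycentric_subdivision[OF f] by blast
  then have "card S \<noteq> card T"
    using simplicial_cxD(2)[OF K] psubset_card_mono by (metis less_irrefl)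
  then show "p (card (inv_into K f a)) \<noteq> p (card (inv_into K f b))"
    using ST f size inj_onD[OF p(1)] by (metis inv_into_f_f)
qed

text \<open>If no colour pair can occur in flat squares of both complexes, every edge of a flat
  square is a witness; the edge at index 0 is used.\<close>

lemma size_gap_colours_avoiding:
  assumes K: "simplicial_cx K" "inj_on f K" and L: "simplicial_cx L" "inj_on g L"
    and pq: "\<And>S T S' T'. \<lbrakk>S \<in> K; T \<in> K; S' \<in> L; T' \<in> L; size_gap (card S) (card T);
      size_gap (card S') (card T')\<rbrakk> \<Longrightarrow> {p (card S), p (card T)} \<noteq> {q (card S'), q (card T')}"
  shows "five_large_against
    (barycentric_subdivision f K) (\<lambda>a. p (card (inv_into K f a)))
    (barycentric_subdivision g L) (\<lambda>b. q (card (inv_into L g b)))"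
  unfolding five_large_against_def
proof (intro allI impI)
  fix v
  assume v: "flat_square (barycentric_subdivision f K) v"
  obtain S T where ST: "S \<in> K" "T \<in> K" "v 0 = f S" "v (Suc 0 mod 4) = f T" "size_gap (card S) (card T)"
    using flat_square_barycentric_subdivision_size_gap[OF K v, of 0] by auto
  have "\<not> has_flat_square_with_colours (barycentric_subdivision g L) (\<lambda>b. q (card (inv_into L g b)))
      (p (card S)) (p (card T))"
    unfolding has_flat_square_with_colours_def
  proof (intro notI, elim exE conjE)
    fix w i
    assume w: "flat_square (barycentric_subdivision g L) w" "i < 4"
      and eq: "{q (card (inv_into L g (w i))), q (card (inv_into L g (w (Suc i mod 4))))}
        = {p (card S), p (card T)}"
    obtain S' T' where ST': "S' \<in> L" "T' \<in> L" "w i = g S'" "w (Suc i mod 4) = g T'"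
        "size_gap (card S') (card T')"
      using flat_square_barycentric_subdivision_size_gap[OF L w] .
    then have "{p (card S), p (card T)} = {q (card S'), q (card T')}"
      using eq L(2) by simp
    then show False
      using pq ST ST' by blast
  qed
  then show "\<exists>j<4. \<not> has_flat_square_with_colours (barycentric_subdivision g L)
      (\<lambda>b. q (card (inv_into L g b))) (p (card (inv_into K f (v j))))
      (p (card (inv_into K f (v (Suc j mod 4)))))"
    using ST K(2) by (intro exI[of _ 0]) auto
qed

section \<open>The permutation separating the colour pairs\<close>

text \<open>For four colours, the pairs of sizes differing by at least two form the path 3 - 1 - 4 - 2,
  which is carried onto the complementary path 1 - 2 - 3 - 4; for three colours, 1 - 3 is carried
  onto 1 - 2.\<close>

definition recolour :: "nat \<Rightarrow> nat \<Rightarrow> nat" where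
  "recolour m = (if m = 4 then id(1 := 2, 2 := 4, 3 := 1, 4 := 3)
                 else if m = 3 then id(2 := 3, 3 := 2) else id)"

lemma recolour_permutes:
  "inj_on (recolour m) {1..m}" "recolour m ` {1..m} \<subseteq> {1..m}"
  by (auto simp: recolour_def inj_on_def)

lemma recolour_size_gap:
  assumes "m \<le> 4" "{a, b, a', b'} \<subseteq> {1..m}" "size_gap a b" "size_gap a' b'"
  shows "{a, b} \<noteq> {recolour m a', recolour m b'}"
proof -
  have gap: "(a, b) \<in> {(1,3), (3,1), (1,4), (4,1), (2,4), (4,2)}"
    if "size_gap a b" "a \<in> {1..m}" "b \<in> {1..m}" for a b
  proof -
    have "a \<in> {1, 2, 3, 4}" "b \<in> {1, 2, 3, 4}"
      using that(2,3) assms(1) by auto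
    then show ?thesis
      using that(1) unfolding size_gap_def by (elim insertE emptyE) simp_all
  qed
  \<comment> \<open>Two sizes in \<open>{1..m}\<close> at distance at least 2 force \<open>m\<close>
    to be at least 3.\<close>
  have "m = 3 \<or> m = 4"
    using assms unfolding size_gap_def by auto
  moreover have "(a, b) \<in> {(1,3), (3,1), (1,4), (4,1), (2,4), (4,2)}"
    "(a', b') \<in> {(1,3), (3,1), (1,4), (4,1), (2,4), (4,2)}"
    using gap assms by blast+
  \<comment> \<open>For \<open>m = 4\<close> the pairs 13, 14, 24 go to 12, 23, 34. For
    \<open>m = 3\<close> the range condition leaves only 13, which goes to 12.\<close>
  ultimately show ?thesis
    using assms(2) by (elim disjE insertE emptyE) (simp_all add: recolour_def doubleton_eq_iff)
qed

theorem propositionE: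
  fixes \<Lambda>\<^sub>A :: "'a set set" and \<Lambda>\<^sub>B :: "'b set set" and n :: int
  assumes "simplicial_cx \<Lambda>\<^sub>A" and "simplicial_cx \<Lambda>\<^sub>B"
    and "cx_dim \<Lambda>\<^sub>A = n" and "cx_dim \<Lambda>\<^sub>B = n" and "n \<le> 3"
  shows "\<exists>(\<Gamma>\<^sub>A :: nat set set) (\<Gamma>\<^sub>B :: nat set set).
           simplicial_cx \<Gamma>\<^sub>A \<and> simplicial_cx \<Gamma>\<^sub>B \<and>
           geom_realization \<Gamma>\<^sub>A homeomorphic geom_realization \<Lambda>\<^sub>A \<and>
           geom_realization \<Gamma>\<^sub>B homeomorphic geom_realization \<Lambda>\<^sub>B \<and>
           (\<exists>c d. cx_colouring (nat (n + 1)) \<Gamma>\<^sub>A c \<and> cx_colouring (nat (n + 1)) \<Gamma>\<^sub>B d \<and>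
                  pairwise_5_large (nat (n + 1)) \<Gamma>\<^sub>A c \<Gamma>\<^sub>B d)"
proof -
  \<comment> \<open>A simplex has between 1 and \<open>n + 1\<close> vertices, so sizes use exactly
    the available colours; the empty complex, with \<open>n = -1\<close>, gives
    \<open>m = 0\<close>.\<close>
  define m where "m = nat (n + 1)"
  have "m \<le> 4"
    using \<open>n \<le> 3\<close> by (simp add: m_def)
  obtain f :: "'a set \<Rightarrow> nat" where f: "inj_on f \<Lambda>\<^sub>A"
    using finite_imp_inj_to_nat_seg[OF simplicial_cxD(1)[OF assms(1)]] by blast
  obtain g :: "'b set \<Rightarrow> nat" where g: "inj_on g \<Lambda>\<^sub>B"
    using finite_imp_inj_to_nat_seg[OF simplicial_cxD(1)[OF assms(2)]] by blast
  have sizeA: "card S \<in> {1..m}" if "S \<in> \<Lambda>\<^sub>A" for S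
    using card_le_cx_dim[OF assms(1) that] simplicial_cxD(2,3)[OF assms(1) that] assms(3)
    by (simp add: m_def Suc_le_eq card_gt_0_iff)
  have sizeB: "card S \<in> {1..m}" if "S \<in> \<Lambda>\<^sub>B" for S
    using card_le_cx_dim[OF assms(2) that] simplicial_cxD(2,3)[OF assms(2) that] assms(4)
    by (simp add: m_def Suc_le_eq card_gt_0_iff)
  let ?A = "barycentric_subdivision f \<Lambda>\<^sub>A" and ?B = "barycentric_subdivision g \<Lambda>\<^sub>B"
  \<comment> \<open>The explicit \<open>id\<close> gives both colourings the same shape, a
    permutation applied to the size.\<close>
  let ?c = "\<lambda>a. id (card (inv_into \<Lambda>\<^sub>A f a))" and ?d = "\<lambda>b. recolour m (card (inv_into \<Lambda>\<^sub>B g b))"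
  have c: "cx_colouring m ?A ?c"
    using sizeA by (intro colouring_barycentric_subdivision[OF assms(1) f]) auto
  have d: "cx_colouring m ?B ?d"
    using sizeB recolour_permutes[of m]
    by (intro colouring_barycentric_subdivision[OF assms(2) g]) auto
  have disjoint: "{id (card S), id (card T)} \<noteq> {recolour m (card S'), recolour m (card T')}"
    if "S \<in> \<Lambda>\<^sub>A" "T \<in> \<Lambda>\<^sub>A" "S' \<in> \<Lambda>\<^sub>B" "T' \<in> \<Lambda>\<^sub>B" "size_gap (card S) (card T)" "size_gap (card S') (card T')"
    for S T S' T'
    using recolour_size_gap[OF \<open>m \<le> 4\<close> _ that(5,6)] sizeA sizeB that by simp
  have "five_large_against ?A ?c ?B ?d"
    using disjoint by (intro size_gap_colours_avoiding[OF assms(1) f assms(2) g])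
  moreover have "five_large_against ?B ?d ?A ?c"
    using disjoint by (intro size_gap_colours_avoiding[OF assms(2) g assms(1) f]) metis
  ultimately have "pairwise_5_large m ?A ?c ?B ?d"
    unfolding pairwise_5_large_def
    by (intro conjI c d simplicial_barycentric_subdivision flag_barycentric_subdivision assms(1,2) f g)
  then show ?thesis
    unfolding m_def[symmetric]
    by (intro exI[of _ ?A] exI[of _ ?B] exI[of _ ?c] exI[of _ ?d] conjI c d
        simplicial_barycentric_subdivision homeomorphic_barycentric_subdivision assms(1,2) f g)
qed

end
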